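(* Let $n\ge2$, let $B(r)\subset\mathbb{R}^n$ be the open ball of radius $r>0$ centered at the origin, let $k\ge2$, and let $p>\frac{n-1}{k-1}$. Then the operator $$S\omega(x)\langle\xi_1,\dots,\xi_{k-1}\rangle=\int_0^1t^{k-1}\,\omega(tx)\langle x,\xi_1,\dots,\xi_{k-1}\rangle\,dt$$ is well defined as an operator $S:\Omega^k_p(B(r))\to\Omega^{k-1}_p(B(r))$, and for every $\omega\in\Omega^k_p(B(r))$ $$\|S\omega\|_{\Omega^{k-1}_p(B(r))}\le\frac{r\sqrt{\binom nk}}{(p(k-1)-n+1)^{1/p}}\,\|\omega\|_{\Omega^k_p(B(r))}.$$
   Context: For $p\in[1,\infty)$, $\Omega^k_p(B(r))$ is the Banach space of (equivalence classes of) measurable differential $k$-forms $\omega$ on $B(r)$ with finite norm $\|\omega\|_{\Omega^k_p(B(r))}=\big(\int_{B(r)}|\omega|_x^p\,dx\big)^{1/p}$, where for $\omega=\sum_{j}f_{j_1,\dots,j_k}dx_{j_1}\wedge\dots\wedge dx_{j_k}$ (sum over strictly increasing multi-indices) the modulus at $x$ is $|\omega|_x=\big(\sum_j f_{j_1,\dots,j_k}(x)^2\big)^{1/2}$. In the formula for $S$, $\xi_1,\dots,\xi_{k-1}\in\mathbb{R}^n$ and $x\in B(r)$. *)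

theory Defs
  imports "HOL-Analysis.Analysis"
begin

text \<open>
  A differential form on a subset of \<open>\<real>\<^sup>n\<close> is represented by a function \<open>\<omega>\<close> whose value
  \<open>\<omega> x [v\<^sub>1, \<dots>, v\<^sub>k]\<close> is the form at \<open>x\<close> evaluated on the vectors \<open>v\<^sub>1, \<dots>, v\<^sub>k\<close>. Values on lists of
  length other than \<open>k\<close> are irrelevant for a \<open>k\<close>-form. The index type carries a linear order
  so that strictly increasing multi-indices make sense.
\<close>

type_synonym 'n diff_form = "real ^ 'n \<Rightarrow> (real ^ 'n) list \<Rightarrow> real"

definition alternating_multilinear ::
    "nat \<Rightarrow> ((real ^ 'n) list \<Rightarrow> real) \<Rightarrow> bool" where
  "alternating_multilinear k \<phi> \<longleftrightarrow>
     (\<forall>vs i. length vs = k \<longrightarrow> i < k \<longrightarrow> linear (\<lambda>v. \<phi> (vs[i := v]))) \<and>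
     (\<forall>vs i j. length vs = k \<longrightarrow> i < j \<longrightarrow> j < k \<longrightarrow> vs ! i = vs ! j \<longrightarrow> \<phi> vs = 0)"

definition multi_indices :: "nat \<Rightarrow> 'n::{finite,linorder} list set" where
  "multi_indices k = {js. length js = k \<and> sorted_wrt (<) js}"

text \<open>
  With the convention \<open>(dx\<^sub>j\<^sub>1 \<and> \<dots> \<and> dx\<^sub>j\<^sub>k) [v\<^sub>1, \<dots>, v\<^sub>k] = det (v\<^sub>b $ j\<^sub>a)\<close> (no factor \<open>1/k!\<close>), the
  coefficient \<open>f\<^sub>J\<close> in \<open>\<omega> = \<Sum>\<^sub>J f\<^sub>J dx\<^sub>J\<close> is the value of \<open>\<omega>\<close> on the standard basis vectors
  indexed by \<open>J\<close>.
\<close>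

definition form_coeff :: "'n::{finite,linorder} diff_form \<Rightarrow> 'n list \<Rightarrow> (real, 'n) vec \<Rightarrow> real" where
  "form_coeff \<omega> js x = \<omega> x (map (\<lambda>j. axis j 1) js)"

definition form_modulus :: "nat \<Rightarrow> 'n::{finite,linorder} diff_form \<Rightarrow> (real, 'n) vec \<Rightarrow> real" where
  "form_modulus k \<omega> x = sqrt (\<Sum>js\<in>multi_indices k. (form_coeff \<omega> js x)\<^sup>2)"

text \<open>
  Representatives of the elements of \<open>\<Omega>\<^sup>k\<^sub>p(B(r))\<close>; two of them represent the same element iff
  they are related by \<open>form_AE_eq\<close> below. Being a \<open>k\<close>-form is required at almost every point
  only, since a representative may be changed or left undefined on a null set.
\<close>

definition Omega :: "nat \<Rightarrow> real \<Rightarrow> real \<Rightarrow> 'n::{finite,linorder} diff_form set" where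
  "Omega k p r = {\<omega>.
     (AE x in lebesgue_on (ball 0 r). alternating_multilinear k (\<omega> x)) \<and>
     (\<forall>js\<in>multi_indices k. form_coeff \<omega> js \<in> borel_measurable (lebesgue_on (ball 0 r))) \<and>
     integrable (lebesgue_on (ball 0 r)) (\<lambda>x. form_modulus k \<omega> x powr p)}"

definition form_AE_eq ::
    "nat \<Rightarrow> real \<Rightarrow> 'n::{finite,linorder} diff_form \<Rightarrow> 'n diff_form \<Rightarrow> bool" where
  "form_AE_eq k r \<omega> \<eta> \<longleftrightarrow>
     (AE x in lebesgue_on (ball 0 r). \<forall>vs. length vs = k \<longrightarrow> \<omega> x vs = \<eta> x vs)"

definition Omega_norm :: "nat \<Rightarrow> real \<Rightarrow> real \<Rightarrow> 'n::{finite,linorder} diff_form \<Rightarrow> real" where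
  "Omega_norm k p r \<omega> =
     (LINT x|lebesgue_on (ball 0 r). form_modulus k \<omega> x powr p) powr (1 / p)"

definition S_integrand ::
    "nat \<Rightarrow> 'n::{finite,linorder} diff_form \<Rightarrow> (real, 'n) vec \<Rightarrow> ((real, 'n) vec) list \<Rightarrow> real \<Rightarrow> real" where
  "S_integrand k \<omega> x \<xi>s t = t ^ (k - 1) * \<omega> (t *\<^sub>R x) (x # \<xi>s)"

definition S_op :: "nat \<Rightarrow> 'n::{finite,linorder} diff_form \<Rightarrow> 'n diff_form" where
  "S_op k \<omega> x \<xi>s = (LINT t:{0..1}|lebesgue. S_integrand k \<omega> x \<xi>s t)"

end

theory Submission
  imports Defs
begin

text \<open>
  For almost every \<open>x\<close> the form \<open>\<Phi>\<^sub>x = \<integral>\<^sub>0\<^sup>1 t\<^sup>k\<^sup>-\<^sup>1 \<omega>(tx) dt\<close> exists and is alternating, and \<open>S\<omega>(x)\<close> is its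
  interior product with \<open>x\<close>. Writing \<open>\<Phi>\<^sub>x\<close> as a sum of \<open>n choose k\<close> basic forms and using the
  triangle inequality, then Cauchy--Schwarz, gives
  \<open>|S\<omega>|\<^sub>x \<le> |x| sqrt (n choose k) \<integral>\<^sub>0\<^sup>1 t\<^sup>k\<^sup>-\<^sup>1 |\<omega>|\<^sub>t\<^sub>x dt\<close>. By Jensen's inequality on \<open>[0,1]\<close> the \<open>p\<close>-th power
  moves under the integral; Tonelli and the substitution \<open>y = tx\<close> then leave the factor
  \<open>\<integral>\<^sub>0\<^sup>1 t powr (p(k-1) - n) dt = 1 / (p(k-1) - n + 1)\<close>, which is finite precisely under the hypothesis on \<open>p\<close>.
\<close>

section \<open>Alternating multilinear forms\<close>

lemma alternating_multilinear_linear: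
  assumes "alternating_multilinear k \<phi>" "length (us @ x # ws) = k"
  shows "linear (\<lambda>v. \<phi> (us @ v # ws))"
  using assms unfolding alternating_multilinear_def
  by (auto dest!: spec[of _ "us @ x # ws"] spec[of _ "length us"])

lemma alternating_multilinear_repeated:
  assumes "alternating_multilinear k \<phi>" "length vs = k" "i < k" "j < k" "i \<noteq> j" "vs ! i = vs ! j"
  shows "\<phi> vs = 0"
  using assms unfolding alternating_multilinear_def by (metis linorder_neqE_nat)

text \<open>Polarization: expanding the value at \<open>a + b\<close> in both adjacent slots, which
  is zero, leaves only the two mixed terms.\<close>

lemma alternating_multilinear_swap:
  assumes "alternating_multilinear k \<phi>" "length (us @ a # b # ws) = k"
  shows "\<phi> (us @ a # b # ws) = - \<phi> (us @ b # a # ws)"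
proof -
  have lin1: "linear (\<lambda>v. \<phi> (us @ v # c # ws))" for c
    using alternating_multilinear_linear[OF assms(1), of us a "c # ws"] assms(2) by simp
  have lin2: "linear (\<lambda>v. \<phi> (us @ c # v # ws))" for c
    using alternating_multilinear_linear[OF assms(1), of "us @ [c]" b ws] assms(2) by simp
  have zero: "\<phi> (us @ c # c # ws) = 0" for c
    using assms(2)
    by (intro alternating_multilinear_repeated[OF assms(1), of _ "length us" "Suc (length us)"])
       (auto simp: nth_append)
  show ?thesis
    using zero[of "a + b"] zero[of a] zero[of b]
      linear_add[OF lin1, of a b "a + b"] linear_add[OF lin2, of a a b] linear_add[OF lin2, of b a b]
    by simp
qed

section \<open>Reordering index lists and the resulting sign\<close>

abbreviation basis_list :: "'n::finite list \<Rightarrow> (real, 'n) vec list" where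
  "basis_list js \<equiv> map (\<lambda>j. axis j 1) js"

text \<open>Moving \<open>i\<close> past one smaller index exchanges adjacent slots and costs a
  factor -1. The sign is quantified before \<open>k\<close> and \<open>\<phi>\<close>, so it depends
  on the index lists alone; the prefix \<open>hs\<close> holds the indices already passed.\<close>

lemma alternating_multilinear_insort:
  fixes i :: "'n::{finite,linorder}"
  shows "\<exists>s::real. \<bar>s\<bar> = 1 \<and> (\<forall>k (\<phi> :: (real, 'n) vec list \<Rightarrow> real).
    alternating_multilinear k \<phi> \<longrightarrow> length (hs @ i # js) = k
    \<longrightarrow> \<phi> (basis_list (hs @ i # js)) = s * \<phi> (basis_list (hs @ insort i js)))"
proof (induction js arbitrary: hs)
  case Nil
  show ?case by (rule exI[of _ 1]) auto
next
  case (Cons j js)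
  show ?case
  proof (cases "i \<le> j")
    case True
    then show ?thesis by (intro exI[of _ 1]) auto
  next
    case False
    obtain s :: real where s: "\<bar>s\<bar> = 1" "\<forall>k (\<phi> :: (real, 'n) vec list \<Rightarrow> real).
      alternating_multilinear k \<phi> \<longrightarrow> length ((hs @ [j]) @ i # js) = k
        \<longrightarrow> \<phi> (basis_list ((hs @ [j]) @ i # js)) = s * \<phi> (basis_list ((hs @ [j]) @ insort i js))"
      using Cons.IH by blast
    show ?thesis
    proof (intro exI[of _ "- s"] conjI allI impI)
      fix k and \<phi> :: "(real, 'n) vec list \<Rightarrow> real"
      assume *: "alternating_multilinear k \<phi>" "length (hs @ i # j # js) = k"
      have "\<phi> (basis_list (hs @ i # j # js)) = - \<phi> (basis_list ((hs @ [j]) @ i # js))"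
        using alternating_multilinear_swap[OF *(1), of "basis_list hs" "axis i 1" "axis j 1"
            "basis_list js"] *(2) by simp
      also have "\<phi> (basis_list ((hs @ [j]) @ i # js)) = s * \<phi> (basis_list ((hs @ [j]) @ insort i js))"
        using s(2) * by simp
      finally show "\<phi> (basis_list (hs @ i # j # js)) = - s * \<phi> (basis_list (hs @ insort i (j # js)))"
        using False by simp
    qed (use s in auto)
  qed
qed

text \<open>Insertion sort: the sign is the product of the signs of the successive insertions, so
  again one sign serves all forms.\<close>

lemma alternating_multilinear_sort:
  fixes js :: "'n::{finite,linorder} list"
  shows "\<exists>s::real. \<bar>s\<bar> = 1 \<and> (\<forall>k (\<phi> :: (real, 'n) vec list \<Rightarrow> real).
    alternating_multilinear k \<phi> \<longrightarrow> length (hs @ js) = k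
    \<longrightarrow> \<phi> (basis_list (hs @ js)) = s * \<phi> (basis_list (hs @ sort js)))"
proof (induction js arbitrary: hs)
  case Nil
  show ?case by (rule exI[of _ 1]) auto
next
  case (Cons j js)
  obtain s :: real where s: "\<bar>s\<bar> = 1" "\<forall>k (\<phi> :: (real, 'n) vec list \<Rightarrow> real).
    alternating_multilinear k \<phi> \<longrightarrow> length ((hs @ [j]) @ js) = k
      \<longrightarrow> \<phi> (basis_list ((hs @ [j]) @ js)) = s * \<phi> (basis_list ((hs @ [j]) @ sort js))"
    using Cons.IH by blast
  obtain s' :: real where s': "\<bar>s'\<bar> = 1"
    "\<forall>k (\<phi> :: (real, 'n) vec list \<Rightarrow> real). alternating_multilinear k \<phi> \<longrightarrow> length (hs @ j # sort js) = k
      \<longrightarrow> \<phi> (basis_list (hs @ j # sort js)) = s' * \<phi> (basis_list (hs @ insort j (sort js)))"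
    using alternating_multilinear_insort[of hs j "sort js"] by blast
  show ?case
  proof (intro exI[of _ "s * s'"] conjI allI impI)
    fix k and \<phi> :: "(real, 'n) vec list \<Rightarrow> real"
    assume *: "alternating_multilinear k \<phi>" "length (hs @ j # js) = k"
    then have "\<phi> (basis_list (hs @ j # js)) = s * \<phi> (basis_list (hs @ j # sort js))"
      using s(2) by simp
    also have "\<phi> (basis_list (hs @ j # sort js)) = s' * \<phi> (basis_list (hs @ insort j (sort js)))"
      using s'(2) * by simp
    finally show "\<phi> (basis_list (hs @ j # js)) = s * s' * \<phi> (basis_list (hs @ sort (j # js)))"
      by simp
  qed (use s s' in \<open>auto simp: abs_mult\<close>)
qed

section \<open>Multi-indices and expansion in basis values\<close>

lemma finite_multi_indices [simp]: "finite (multi_indices k :: 'n::{finite,linorder} list set)"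
  by (rule finite_subset[OF _ finite_lists_length_eq[of UNIV k]]) (auto simp: multi_indices_def)

lemma sorted_list_in_multi_indices_iff:
  "sorted js \<Longrightarrow> js \<in> multi_indices k \<longleftrightarrow> length js = k \<and> distinct js"
  by (auto simp: multi_indices_def strict_sorted_iff)

text \<open>A strictly increasing list is determined by its set of entries, so these lists
  correspond to the subsets with \<open>k\<close> elements.\<close>

lemma card_multi_indices:
  "card (multi_indices k :: 'n::{finite,linorder} list set) = CARD('n) choose k"
proof -
  have "bij_betw set (multi_indices k :: 'n list set) {A. A \<subseteq> UNIV \<and> card A = k}"
  proof (rule bij_betwI[where g = sorted_list_of_set])
    show "set \<in> (multi_indices k :: 'n list set) \<rightarrow> {A. A \<subseteq> UNIV \<and> card A = k}"
      by (auto simp: multi_indices_def strict_sorted_iff distinct_card)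
    show "sorted_list_of_set (set js) = js" if "js \<in> multi_indices k" for js :: "'n list"
      using that by (auto simp: multi_indices_def strict_sorted_iff sorted_distinct_set_unique)
  qed (auto simp: multi_indices_def)
  then show ?thesis
    using n_subsets[of "UNIV :: 'n set" k] by (simp add: bij_betw_same_card)
qed

lemma alternating_multilinear_eq_zero_not_distinct:
  assumes "alternating_multilinear k \<phi>" "length js = k" "\<not> distinct js"
  shows "\<phi> (basis_list js) = 0"
  using assms(3) alternating_multilinear_repeated[OF assms(1), of "basis_list js"] assms(2)
  by (auto simp: distinct_conv_nth)

lemma linear_axis_expansion:
  fixes f :: "(real, 'n::finite) vec \<Rightarrow> real"
  assumes "linear f"
  shows "f v = (\<Sum>j\<in>UNIV. v $ j * f (axis j 1))"
proof -
  have "f v = f (\<Sum>j\<in>UNIV. v $ j *\<^sub>R axis j 1)"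
    using basis_expansion[of v] by (simp add: scalar_mult_eq_scaleR)
  also have "\<dots> = (\<Sum>j\<in>UNIV. v $ j * f (axis j 1))"
    by (simp add: linear_sum[OF assms] linear_cmul[OF assms] o_def)
  finally show ?thesis .
qed

text \<open>The entries of \<open>vs\<close> are expanded one at a time in the standard basis, the
  prefix \<open>hs\<close> collecting the indices chosen so far. The coefficients are fixed before
  \<open>\<phi>\<close>, which later lets them act as constants when the form varies with
  \<open>t\<close>.\<close>

lemma alternating_multilinear_expansion:
  fixes vs :: "(real, 'n::{finite,linorder}) vec list"
  obtains c where "\<And>\<phi>. alternating_multilinear (length vs) \<phi>
    \<Longrightarrow> \<phi> vs = (\<Sum>js\<in>multi_indices (length vs). c js * \<phi> (basis_list js))"
proof -
  have "\<exists>c. \<forall>\<phi>. alternating_multilinear k \<phi> \<longrightarrow>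
     \<phi> (basis_list hs @ vs) = (\<Sum>js\<in>multi_indices k. c js * \<phi> (basis_list js))"
    if "length hs + length vs = k" for hs k
    using that
  proof (induction vs arbitrary: hs)
    case Nil
    obtain s :: real where s: "\<forall>k (\<phi> :: (real, 'n) vec list \<Rightarrow> real). alternating_multilinear k \<phi>
      \<longrightarrow> length hs = k \<longrightarrow> \<phi> (basis_list hs) = s * \<phi> (basis_list (sort hs))"
      using alternating_multilinear_sort[of "[]" hs] by auto
    show ?case
    \<comment> \<open>Once every entry is a basis vector, only the coefficient at
      \<open>sort hs\<close> survives. If \<open>hs\<close> repeats an index, \<open>sort hs\<close>
      is no multi-index and the value is zero.\<close>
    proof (intro exI[of _ "\<lambda>js. if js = sort hs then s else 0"] allI impI)
      fix \<phi> :: "(real, 'n) vec list \<Rightarrow> real"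
      assume *: "alternating_multilinear k \<phi>"
      have "(\<Sum>js\<in>multi_indices k. (if js = sort hs then s else 0) * \<phi> (basis_list js))
        = (\<Sum>js\<in>multi_indices k. if js = sort hs then s * \<phi> (basis_list (sort hs)) else 0)"
        by (intro sum.cong) auto
      also have "\<dots> = (if sort hs \<in> multi_indices k then s * \<phi> (basis_list (sort hs)) else 0)"
        by simp
      also have "\<dots> = s * \<phi> (basis_list (sort hs))"
        using Nil alternating_multilinear_eq_zero_not_distinct[OF *, of "sort hs"]
        by (simp add: sorted_list_in_multi_indices_iff)
      also have "\<dots> = \<phi> (basis_list hs @ [])"
        using s * Nil by simp
      finally show "\<phi> (basis_list hs @ [])
        = (\<Sum>js\<in>multi_indices k. (if js = sort hs then s else 0) * \<phi> (basis_list js))" ..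
    qed
  next
    case (Cons v vs)
    have "\<forall>j. \<exists>c. \<forall>\<phi>. alternating_multilinear k \<phi> \<longrightarrow>
      \<phi> (basis_list (hs @ [j]) @ vs) = (\<Sum>js\<in>multi_indices k. c js * \<phi> (basis_list js))"
      using Cons.prems by (intro allI Cons.IH) simp
    from choice[OF this] obtain c where c: "\<And>j \<phi>. alternating_multilinear k \<phi> \<Longrightarrow>
      \<phi> (basis_list (hs @ [j]) @ vs) = (\<Sum>js\<in>multi_indices k. c j js * \<phi> (basis_list js))"
      by blast
    show ?case
    proof (intro exI[of _ "\<lambda>js. \<Sum>j\<in>UNIV. v $ j * c j js"] allI impI)
      fix \<phi> :: "(real, 'n) vec list \<Rightarrow> real"
      assume *: "alternating_multilinear k \<phi>"
      have "\<phi> (basis_list hs @ v # vs) = (\<Sum>j\<in>UNIV. v $ j * \<phi> (basis_list hs @ axis j 1 # vs))"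
        using Cons.prems
        by (intro linear_axis_expansion alternating_multilinear_linear[OF *, of _ v]) simp
      also have "\<dots> = (\<Sum>j\<in>UNIV. v $ j * (\<Sum>js\<in>multi_indices k. c j js * \<phi> (basis_list js)))"
        using c[OF *] by simp
      also have "\<dots> = (\<Sum>j\<in>UNIV. \<Sum>js\<in>multi_indices k. v $ j * c j js * \<phi> (basis_list js))"
        by (simp add: sum_distrib_left mult.assoc)
      also have "\<dots> = (\<Sum>js\<in>multi_indices k. \<Sum>j\<in>UNIV. v $ j * c j js * \<phi> (basis_list js))"
        by (rule sum.swap)
      also have "\<dots> = (\<Sum>js\<in>multi_indices k. (\<Sum>j\<in>UNIV. v $ j * c j js) * \<phi> (basis_list js))"
        by (simp add: sum_distrib_right)
      finally show "\<phi> (basis_list hs @ v # vs)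
        = (\<Sum>js\<in>multi_indices k. (\<Sum>j\<in>UNIV. v $ j * c j js) * \<phi> (basis_list js))" .
    qed
  qed
  from this[of "[]" "length vs"] obtain c where "\<forall>\<phi>. alternating_multilinear (length vs) \<phi>
    \<longrightarrow> \<phi> vs = (\<Sum>js\<in>multi_indices (length vs). c js * \<phi> (basis_list js))"
    by auto
  then show ?thesis by (intro that[of c]) blast
qed

section \<open>Interior product with a vector\<close>

lemma alternating_multilinear_interior_product:
  fixes x :: "(real, 'n::finite) vec"
  assumes "alternating_multilinear (Suc k) \<phi>"
  shows "alternating_multilinear k (\<lambda>vs. \<phi> (x # vs))"
  unfolding alternating_multilinear_def
proof (intro conjI allI impI)
  fix vs :: "(real, 'n) vec list" and i :: nat
  assume "length vs = k" "i < k"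
  then show "linear (\<lambda>v. \<phi> (x # vs[i := v]))"
    using assms unfolding alternating_multilinear_def
    by (auto dest!: spec[of _ "x # vs"] spec[of _ "Suc i"])
next
  fix vs :: "(real, 'n) vec list" and i j
  assume "length vs = k" "i < j" "j < k" "vs ! i = vs ! j"
  then show "\<phi> (x # vs) = 0"
    by (intro alternating_multilinear_repeated[OF assms, of _ "Suc i" "Suc j"]) auto
qed

text \<open>
  The sign \<open>s\<close> depends only on the list of indices; the inner sum has at most one term, the index
  that completes \<open>is\<close> to a permutation of \<open>js\<close>.
\<close>

lemma interior_product_basis:
  obtains s :: "'n::{finite,linorder} list \<Rightarrow> real" where "\<And>js. \<bar>s js\<bar> = 1"
    "\<And>k \<phi> x is. alternating_multilinear (Suc k) \<phi> \<Longrightarrow> length is = k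
      \<Longrightarrow> \<phi> (x # basis_list is) = (\<Sum>js\<in>multi_indices (Suc k).
        (\<Sum>j\<in>{j. sort (j # is) = js}. x $ j * s (j # is)) * \<phi> (basis_list js))"
proof -
  have "\<forall>js. \<exists>s::real. \<bar>s\<bar> = 1 \<and> (\<forall>k (\<phi> :: (real, 'n) vec list \<Rightarrow> real).
    alternating_multilinear k \<phi> \<longrightarrow> length js = k \<longrightarrow> \<phi> (basis_list js) = s * \<phi> (basis_list (sort js)))"
  proof
    fix js :: "'n list"
    show "\<exists>s::real. \<bar>s\<bar> = 1 \<and> (\<forall>k (\<phi> :: (real, 'n) vec list \<Rightarrow> real).
      alternating_multilinear k \<phi> \<longrightarrow> length js = k \<longrightarrow> \<phi> (basis_list js) = s * \<phi> (basis_list (sort js)))"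
      using alternating_multilinear_sort[of "[]" js] by simp
  qed
  from choice[OF this] obtain s :: "'n list \<Rightarrow> real" where
    s: "\<forall>js. \<bar>s js\<bar> = 1 \<and> (\<forall>k (\<phi> :: (real, 'n) vec list \<Rightarrow> real).
      alternating_multilinear k \<phi> \<longrightarrow> length js = k \<longrightarrow> \<phi> (basis_list js) = s js * \<phi> (basis_list (sort js)))"
    by blast
  show ?thesis
  proof (rule that)
    fix k and \<phi> :: "(real, 'n) vec list \<Rightarrow> real" and x :: "(real, 'n) vec" and "is" :: "'n list"
    assume *: "alternating_multilinear (Suc k) \<phi>" "length is = k"
    \<comment> \<open>An index \<open>j\<close> lies outside \<open>?J\<close> exactly when
      \<open>j # is\<close> has a repetition, and then its term vanishes.\<close>
    let ?J = "{j. sort (j # is) \<in> multi_indices (Suc k)}"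
    have zero: "\<phi> (basis_list (j # is)) = 0" if "j \<notin> ?J" for j
      using that *(2) alternating_multilinear_eq_zero_not_distinct[OF *(1), of "j # is"]
      by (auto simp: sorted_list_in_multi_indices_iff sorted_insort distinct_insort)
    have "\<phi> (x # basis_list is) = (\<Sum>j\<in>UNIV. x $ j * \<phi> (basis_list (j # is)))"
      using linear_axis_expansion[OF alternating_multilinear_linear[OF *(1), of "[]" x "basis_list is"], of x]
        *(2) by simp
    also have "\<dots> = (\<Sum>j\<in>?J. x $ j * \<phi> (basis_list (j # is)))"
      using zero by (intro sum.mono_neutral_right) auto
    also have "\<dots> = (\<Sum>j\<in>?J. x $ j * s (j # is) * \<phi> (basis_list (sort (j # is))))"
    proof (rule sum.cong[OF refl])
      fix j
      show "x $ j * \<phi> (basis_list (j # is)) = x $ j * s (j # is) * \<phi> (basis_list (sort (j # is)))"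
        using s * by (simp del: sort_key_simps)
    qed
    also have "\<dots> = (\<Sum>js\<in>multi_indices (Suc k). \<Sum>j\<in>{j\<in>?J. sort (j # is) = js}.
        x $ j * s (j # is) * \<phi> (basis_list (sort (j # is))))"
      by (rule sum.group[symmetric]) (auto simp del: sort_key_simps)
    also have "\<dots> = (\<Sum>js\<in>multi_indices (Suc k).
        (\<Sum>j\<in>{j. sort (j # is) = js}. x $ j * s (j # is)) * \<phi> (basis_list js))"
      unfolding sum_distrib_right by (intro sum.cong refl) (auto simp del: sort_key_simps)
    finally show "\<phi> (x # basis_list is) = (\<Sum>js\<in>multi_indices (Suc k).
        (\<Sum>j\<in>{j. sort (j # is) = js}. x $ j * s (j # is)) * \<phi> (basis_list js))" .
  qed (use s in blast)
qed

text \<open>For fixed \<open>js\<close> each \<open>is\<close> contributes at most one summand, plus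
  or minus a coordinate \<open>x $ j\<close>, and different \<open>is\<close> use different
  \<open>j\<close>. Hence the sum of squares runs over a subset of the squared coordinates of
  \<open>x\<close>.\<close>

lemma L2_interior_product_basis_le:
  fixes x :: "(real, 'n::{finite,linorder}) vec"
  assumes "\<And>js. \<bar>s js\<bar> = (1::real)"
  shows "L2_set (\<lambda>is. \<Sum>j\<in>{j. sort (j # is) = js}. x $ j * s (j # is)) (multi_indices k) \<le> norm x"
proof -
  have inj1: "j = j'" if "sort (j # is) = sort (j' # is)" for j j' :: 'n and "is"
    using arg_cong[OF that, of mset] by (simp del: sort_key_simps)
  have inj2: "is = is'" if "sort (j # is) = sort (j # is')" "is \<in> multi_indices k" "is' \<in> multi_indices k"
    for j :: 'n and "is" is'
  proof -
    have "mset is' = mset is"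
      using arg_cong[OF that(1), of mset] by (simp del: sort_key_simps)
    moreover have "sorted is" "sorted is'"
      using that(2,3) by (simp_all add: multi_indices_def strict_sorted_imp_sorted)
    ultimately show ?thesis
      using properties_for_sort[of is' "is"] by (simp add: sorted_sort_id)
  qed
  have "(\<Sum>is\<in>multi_indices k. (\<Sum>j\<in>{j. sort (j # is) = js}. x $ j * s (j # is))\<^sup>2)
    = (\<Sum>is\<in>multi_indices k. \<Sum>j\<in>{j. sort (j # is) = js}. (x $ j)\<^sup>2)"
  proof (rule sum.cong[OF refl])
    fix "is"
    have s2: "(s js)\<^sup>2 = 1" for js unfolding power2_abs[of "s js", symmetric] assms by simp
    show "(\<Sum>j\<in>{j. sort (j # is) = js}. x $ j * s (j # is))\<^sup>2 = (\<Sum>j\<in>{j. sort (j # is) = js}. (x $ j)\<^sup>2)"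
    proof (cases "\<exists>j. sort (j # is) = js")
      case True
      then obtain i where i: "sort (i # is) = js" by blast
      have "j = i" if "sort (j # is) = js" for j
        using that i by (intro inj1[of j "is" i]) simp
      then have "{j. sort (j # is) = js} = {i}"
        using i by blast
      then show ?thesis
        by (simp del: sort_key_simps add: power_mult_distrib s2)
    next
      case False
      then have "{j. sort (j # is) = js} = {}"
        by (simp del: sort_key_simps)
      then show ?thesis by (simp del: sort_key_simps)
    qed
  qed
  also have "\<dots> = (\<Sum>(is, j) \<in> (SIGMA is:multi_indices k. {j. sort (j # is) = js}). (x $ j)\<^sup>2)"
    by (rule sum.Sigma) (simp_all del: sort_key_simps)
  also have "\<dots> = (\<Sum>j\<in>snd ` (SIGMA is:multi_indices k. {j. sort (j # is) = js}). (x $ j)\<^sup>2)"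
  proof -
    have "inj_on snd (SIGMA is:multi_indices k. {j. sort (j # is) = js})"
    proof (rule inj_onI)
      fix u v
      assume "u \<in> (SIGMA is:multi_indices k. {j. sort (j # is) = js})"
        and "v \<in> (SIGMA is:multi_indices k. {j. sort (j # is) = js})" and "snd u = snd v"
      then show "u = v"
        by (intro prod_eqI inj2[of "snd u" "fst u" "fst v"])
           (auto simp: mem_Sigma_iff simp del: sort_key_simps)
    qed
    then show ?thesis by (simp add: sum.reindex case_prod_beta)
  qed
  also have "\<dots> \<le> (\<Sum>j\<in>UNIV. (x $ j)\<^sup>2)"
    by (intro sum_mono2) auto
  finally show ?thesis
    by (auto simp: L2_set_def norm_vec_def intro!: real_sqrt_le_mono)
qed

lemma L2_set_sum_le:
  assumes "finite J"
  shows "L2_set (\<lambda>i. \<Sum>j\<in>J. f j i) I \<le> (\<Sum>j\<in>J. L2_set (f j) I)"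
  using assms
proof induction
  case (insert j J)
  then show ?case using L2_set_triangle_ineq[of "f j" "\<lambda>i. \<Sum>j\<in>J. f j i" I] by auto
qed (auto simp: L2_set_def)

text \<open>Each basic form contracted with \<open>x\<close> has Euclidean length at most
  \<open>norm x\<close>, and the triangle inequality adds these up. The sum of absolute values on
  the right is what later produces the binomial factor.\<close>

lemma interior_product_modulus_le:
  fixes x :: "(real, 'n::{finite,linorder}) vec"
  assumes "alternating_multilinear (Suc k) \<phi>"
  shows "L2_set (\<lambda>is. \<phi> (x # basis_list is)) (multi_indices k)
    \<le> norm x * (\<Sum>js\<in>multi_indices (Suc k). \<bar>\<phi> (basis_list js)\<bar>)"
proof -
  obtain s :: "'n list \<Rightarrow> real" where s: "\<And>js. \<bar>s js\<bar> = 1"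
    "\<And>k \<phi> x is. alternating_multilinear (Suc k) \<phi> \<Longrightarrow> length is = k
      \<Longrightarrow> \<phi> (x # basis_list is) = (\<Sum>js\<in>multi_indices (Suc k).
        (\<Sum>j\<in>{j. sort (j # is) = js}. x $ j * s (j # is)) * \<phi> (basis_list js))"
    using interior_product_basis by blast
  define a where "a js is = (\<Sum>j\<in>{j. sort (j # is) = js}. x $ j * s (j # is))" for js "is"
  have "L2_set (\<lambda>is. \<phi> (x # basis_list is)) (multi_indices k)
      = L2_set (\<lambda>is. \<Sum>js\<in>multi_indices (Suc k). a js is * \<phi> (basis_list js)) (multi_indices k)"
    unfolding a_def by (intro L2_set_cong refl s(2)[OF assms]) (auto simp: multi_indices_def)
  also have "\<dots> \<le> (\<Sum>js\<in>multi_indices (Suc k). L2_set (\<lambda>is. a js is * \<phi> (basis_list js)) (multi_indices k))"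
    by (rule L2_set_sum_le) simp
  also have "\<dots> = (\<Sum>js\<in>multi_indices (Suc k). L2_set (a js) (multi_indices k) * \<bar>\<phi> (basis_list js)\<bar>)"
    by (simp add: L2_set_def power_mult_distrib real_sqrt_mult flip: sum_distrib_right)
  also have "\<dots> \<le> (\<Sum>js\<in>multi_indices (Suc k). norm x * \<bar>\<phi> (basis_list js)\<bar>)"
    unfolding a_def by (intro sum_mono mult_right_mono L2_interior_product_basis_le s) auto
  finally show ?thesis by (simp add: sum_distrib_left)
qed

section \<open>Integrals of families of alternating forms\<close>

lemma alternating_multilinear_integral:
  fixes \<phi> :: "'a \<Rightarrow> (real, 'n::{finite,linorder}) vec list \<Rightarrow> real"
  assumes alt: "AE t in M. alternating_multilinear k (\<phi> t)"
    and meas: "\<And>vs. length vs = k \<Longrightarrow> integrable M (\<lambda>t. w t * \<phi> t vs)"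
  shows "alternating_multilinear k (\<lambda>vs. LINT t|M. w t * \<phi> t vs)"
  unfolding alternating_multilinear_def
proof (intro conjI allI impI)
  fix vs :: "(real, 'n) vec list" and i :: nat
  assume vs: "length vs = k" "i < k"
  have lin: "AE t in M. linear (\<lambda>v. \<phi> t (vs[i := v]))"
    using alt by eventually_elim (use vs in \<open>auto simp: alternating_multilinear_def\<close>)
  \<comment> \<open>A non-integrable function has integral 0 by convention, so additivity of the
    integral rests on the integrability of each value.\<close>
  have int: "integrable M (\<lambda>t. w t * \<phi> t (vs[i := v]))" for v
    using meas vs by simp
  show "linear (\<lambda>v. LINT t|M. w t * \<phi> t (vs[i := v]))"
  proof
    fix a b :: "(real, 'n) vec"
    have "(LINT t|M. w t * \<phi> t (vs[i := a + b]))
      = (LINT t|M. w t * \<phi> t (vs[i := a]) + w t * \<phi> t (vs[i := b]))"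
    proof (rule integral_cong_AE)
      show "AE t in M. w t * \<phi> t (vs[i := a + b]) = w t * \<phi> t (vs[i := a]) + w t * \<phi> t (vs[i := b])"
        using lin by eventually_elim (auto dest!: linear_add[of _ a b] simp: distrib_left)
    qed (intro borel_measurable_integrable Bochner_Integration.integrable_add int)+
    then show "(LINT t|M. w t * \<phi> t (vs[i := a + b]))
      = (LINT t|M. w t * \<phi> t (vs[i := a])) + (LINT t|M. w t * \<phi> t (vs[i := b]))"
      by (simp add: int)
  next
    fix c and a :: "(real, 'n) vec"
    have "(LINT t|M. w t * \<phi> t (vs[i := c *\<^sub>R a])) = (LINT t|M. c * (w t * \<phi> t (vs[i := a])))"
    proof (rule integral_cong_AE)
      show "AE t in M. w t * \<phi> t (vs[i := c *\<^sub>R a]) = c * (w t * \<phi> t (vs[i := a]))"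
        using lin by eventually_elim (auto dest!: linear_cmul[of _ c a])
    qed (intro borel_measurable_integrable integrable_mult_right int)+
    then show "(LINT t|M. w t * \<phi> t (vs[i := c *\<^sub>R a])) = c *\<^sub>R (LINT t|M. w t * \<phi> t (vs[i := a]))"
      by simp
  qed
next
  fix vs :: "(real, 'n) vec list" and i j
  assume vs: "length vs = k" "i < j" "j < k" "vs ! i = vs ! j"
  have "AE t in M. w t * \<phi> t vs = 0"
    using alt by eventually_elim (use vs in \<open>auto simp: alternating_multilinear_def\<close>)
  then show "(LINT t|M. w t * \<phi> t vs) = 0"
    by (rule integral_eq_zero_AE)
qed

text \<open>Lebesgue measure is complete, so a change on a null set preserves measurability;
  extension by zero outside \<open>S\<close> moves the question to the whole space.\<close>

lemma borel_measurable_lebesgue_on_AE: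
  fixes f g :: "'a::euclidean_space \<Rightarrow> real"
  assumes "f \<in> borel_measurable (lebesgue_on S)" and ae: "AE x in lebesgue_on S. f x = g x"
    and S: "S \<in> sets lebesgue"
  shows "g \<in> borel_measurable (lebesgue_on S)"
proof -
  have "(\<lambda>x. if x \<in> S then f x else 0) \<in> borel_measurable lebesgue"
    using assms(1) S by (rule borel_measurable_if_I)
  moreover have "AE x in lebesgue. (if x \<in> S then f x else 0) = (if x \<in> S then g x else 0)"
    using ae S by (simp add: AE_restrict_space_iff)
  ultimately show ?thesis
    by (rule borel_measurable_if_D[OF borel_measurable_AE])
qed

text \<open>The value at \<open>vs\<close> is, for almost every \<open>t\<close>, a linear
  combination of values on basis vectors with coefficients not depending on \<open>t\<close>.
  Measurability has to be transferred along this almost everywhere equality too.\<close>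

lemma integrable_alternating_multilinear:
  fixes \<phi> :: "'a::euclidean_space \<Rightarrow> (real, 'n::{finite,linorder}) vec list \<Rightarrow> real"
  assumes S: "S \<in> sets lebesgue" and alt: "AE t in lebesgue_on S. alternating_multilinear k (\<phi> t)"
    and int: "\<And>js. js \<in> multi_indices k \<Longrightarrow> integrable (lebesgue_on S) (\<lambda>t. w t * \<phi> t (basis_list js))"
    and vs: "length vs = k"
  shows "integrable (lebesgue_on S) (\<lambda>t. w t * \<phi> t vs)"
proof -
  obtain c where c: "\<And>\<phi>. alternating_multilinear k \<phi>
    \<Longrightarrow> \<phi> vs = (\<Sum>js\<in>multi_indices k. c js * \<phi> (basis_list js))"
    using alternating_multilinear_expansion[of vs] vs by blast
  let ?g = "\<lambda>t. \<Sum>js\<in>multi_indices k. c js * (w t * \<phi> t (basis_list js))"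
  have g: "integrable (lebesgue_on S) ?g"
    by (intro Bochner_Integration.integrable_sum integrable_mult_right int)
  have ae: "AE t in lebesgue_on S. ?g t = w t * \<phi> t vs"
    using alt
  proof eventually_elim
    case (elim t)
    show ?case unfolding c[OF elim] by (simp add: sum_distrib_left mult_ac)
  qed
  show ?thesis
    by (rule integrable_cong_AE_imp[OF g _ ae])
       (rule borel_measurable_lebesgue_on_AE[OF borel_measurable_integrable[OF g] ae S])
qed

section \<open>Integration along rays\<close>

text \<open>A dilation multiplies Lebesgue measure by a positive constant and hence preserves null
  sets.\<close>

lemma AE_lborel_scaleR:
  fixes P :: "'a::euclidean_space \<Rightarrow> bool"
  assumes "c \<noteq> 0" "Measurable.pred borel P" "AE x in lborel. P x"
  shows "AE x in lborel. P (c *\<^sub>R x)"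
  using assms
  by (subst lborel_affine[where t = 0 and c = "1 / c"]) (simp_all add: AE_density AE_distr_iff)

lemma nn_integral_lborel_scaleR:
  fixes f :: "'a::euclidean_space \<Rightarrow> ennreal"
  assumes [measurable]: "f \<in> borel_measurable borel" and "c \<noteq> 0"
  shows "(\<integral>\<^sup>+x. f x \<partial>lborel) = ennreal (\<bar>c\<bar> ^ DIM('a)) * (\<integral>\<^sup>+x. f (c *\<^sub>R x) \<partial>lborel)"
  using assms(2)
  by (subst lborel_affine[where t = 0 and c = c])
     (simp_all add: nn_integral_density nn_integral_distr nn_integral_cmult)

text \<open>A ray may itself be a null set, so only almost every ray can be reached. For each fixed
  \<open>t \<noteq> 0\<close> the dilated exceptional set is null, Fubini exchanges the two
  almost-every quantifiers, and \<open>t *\<^sub>R x\<close> stays in the ball.\<close>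

lemma AE_lebesgue_on_rays:
  fixes P :: "'a::euclidean_space \<Rightarrow> bool"
  assumes "AE y in lebesgue_on (ball 0 r). P y"
  shows "AE x in lebesgue_on (ball 0 r). AE t in lebesgue_on {0..1}. P (t *\<^sub>R x)"
proof -
  have "AE y in lborel. y \<in> ball 0 r \<longrightarrow> P y"
    using assms by (simp add: AE_restrict_space_iff AE_completion_iff)
  \<comment> \<open>The exceptional set may fail to be Borel; the larger Borel null set
    \<open>N\<close> gives the joint measurability used when the quantifiers are exchanged.\<close>
  then obtain N where N: "{y \<in> space lborel. \<not> (y \<in> ball 0 r \<longrightarrow> P y)} \<subseteq> N" "N \<in> null_sets lborel"
    unfolding eventually_ae_filter by auto
  have [measurable]: "N \<in> sets borel"
    using N(2) by auto
  have "AE t in lborel. AE x in lborel. t \<noteq> 0 \<longrightarrow> t *\<^sub>R x \<notin> N"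
  proof (rule AE_I2)
    fix t :: real
    show "AE x in lborel. t \<noteq> 0 \<longrightarrow> t *\<^sub>R x \<notin> N"
      using AE_lborel_scaleR[of t "\<lambda>y. y \<notin> N"] AE_not_in[OF N(2)] by (cases "t = 0") auto
  qed
  then have "AE x in lborel. AE t in lborel. t \<noteq> 0 \<longrightarrow> t *\<^sub>R x \<notin> N"
    by (subst lborel_pair.AE_commute[symmetric]) measurable
  then have "AE x in lborel. x \<in> ball 0 r \<longrightarrow> (AE t in lborel. t \<in> {0..1} \<longrightarrow> P (t *\<^sub>R x))"
  proof eventually_elim
    case (elim x)
    show ?case
    proof
      assume x: "x \<in> ball 0 r"
      show "AE t in lborel. t \<in> {0..1} \<longrightarrow> P (t *\<^sub>R x)"
        \<comment> \<open>At \<open>t = 0\<close> every ray passes through the origin, so this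
          single value is discarded as a null set.\<close>
        using elim AE_lborel_singleton[of "0::real"]
      proof eventually_elim
        case (elim t)
        show ?case
        proof
          assume t: "t \<in> {0..1}"
          then have "norm (t *\<^sub>R x) \<le> norm x"
            by (auto intro: mult_left_le_one_le)
          then have "t *\<^sub>R x \<in> ball 0 r"
            using x by (simp del: norm_scaleR)
          then show "P (t *\<^sub>R x)"
            using N(1) elim unfolding space_lborel space_borel by blast
        qed
      qed
    qed
  qed
  then show ?thesis
    by (simp add: AE_restrict_space_iff AE_completion_iff)
qed

section \<open>Measurability and Tonelli along rays\<close>

lemma nn_integral_lebesgue_on_eq_lborel:
  fixes f :: "'a::euclidean_space \<Rightarrow> ennreal"
  assumes [measurable]: "f \<in> borel_measurable borel" "S \<in> sets borel"
  shows "(\<integral>\<^sup>+x. f x \<partial>lebesgue_on S) = (\<integral>\<^sup>+x. f x * indicator S x \<partial>lborel)"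
  by (simp add: nn_integral_restrict_space nn_integral_completion)

lemma integral_lebesgue_on_eq_lborel:
  fixes f :: "'a::euclidean_space \<Rightarrow> real"
  assumes [measurable]: "f \<in> borel_measurable borel" "S \<in> sets borel"
  shows "(LINT x|lebesgue_on S. f x) = (LINT x|lborel. indicator S x * f x)"
  by (simp add: integral_restrict_space integral_completion)

text \<open>Tonelli for \<open>f (t *\<^sub>R x)\<close> on a product of Borel spaces asks for a
  Borel function, so a Lebesgue measurable \<open>f\<close> is replaced by a Borel
  representative.\<close>

lemma lebesgue_on_ex_borel_measurable:
  fixes f :: "'a::euclidean_space \<Rightarrow> real"
  assumes "f \<in> borel_measurable (lebesgue_on S)" "S \<in> sets lebesgue"
  obtains g where "g \<in> borel_measurable borel" "AE x in lebesgue_on S. f x = g x"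
proof -
  have "(\<lambda>x. if x \<in> S then f x else 0) \<in> borel_measurable (completion lborel)"
    using assms by (rule borel_measurable_if_I)
  then obtain g where g: "g \<in> borel_measurable lborel"
      "AE x in lborel. (if x \<in> S then f x else 0) = g x"
    using completion_ex_borel_measurable_real by blast
  have "AE x in lebesgue_on S. f x = g x"
    using AE_completion[OF g(2)] assms(2)
    by (auto simp: AE_restrict_space_iff elim!: eventually_mono)
  then show ?thesis using that g(1) by simp
qed

text \<open>Tonelli puts the integral over \<open>x\<close> inside, the substitution
  \<open>y = t *\<^sub>R x\<close> costs a factor \<open>t powr (- n)\<close>, and the remaining
  integral of \<open>t powr (q - n)\<close> over \<open>[0, 1]\<close> is finite because
  \<open>q - n > - 1\<close>.\<close>

lemma nn_integral_rays_le:
  fixes g :: "'a::euclidean_space \<Rightarrow> ennreal"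
  assumes [measurable]: "g \<in> borel_measurable borel" and q: "q > real DIM('a) - 1"
  shows "(\<integral>\<^sup>+x. (\<integral>\<^sup>+t. ennreal (t powr q) * g (t *\<^sub>R x) * indicator {0..1} t \<partial>lborel) * indicator (ball 0 r) x \<partial>lborel)
    \<le> ennreal (1 / (q - real DIM('a) + 1)) * (\<integral>\<^sup>+x. g x * indicator (ball 0 r) x \<partial>lborel)"
proof -
  define n where "n = DIM('a)"
  \<comment> \<open>Extension by zero turns the integral over the ball into one over the whole
    space. This can only enlarge the left side, since \<open>t *\<^sub>R x\<close> may lie in the
    ball when \<open>x\<close> does not.\<close>
  define G where "G y = g y * indicator (ball 0 r) y" for y
  have [measurable]: "ball 0 r \<in> sets (borel :: 'a measure)"
    by simp
  have [measurable]: "G \<in> borel_measurable borel"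
    unfolding G_def by measurable
  define H where "H = (\<integral>\<^sup>+x. G x \<partial>lborel)"
  have "(\<integral>\<^sup>+x. (\<integral>\<^sup>+t. ennreal (t powr q) * g (t *\<^sub>R x) * indicator {0..1} t \<partial>lborel) * indicator (ball 0 r) x \<partial>lborel)
     \<le> (\<integral>\<^sup>+x. (\<integral>\<^sup>+t. ennreal (t powr q) * indicator {0..1} t * G (t *\<^sub>R x) \<partial>lborel) \<partial>lborel)"
  proof (rule nn_integral_mono)
    fix x :: 'a
    show "(\<integral>\<^sup>+t. ennreal (t powr q) * g (t *\<^sub>R x) * indicator {0..1} t \<partial>lborel) * indicator (ball 0 r) x
      \<le> (\<integral>\<^sup>+t. ennreal (t powr q) * indicator {0..1} t * G (t *\<^sub>R x) \<partial>lborel)"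
    proof (cases "x \<in> ball 0 r")
      case True
      have "norm (t *\<^sub>R x) < r" if "t \<in> {0..1}" for t
        using True that mult_left_le_one_le[of "norm x" t] by auto
      with True show ?thesis
        by (auto intro!: nn_integral_mono simp: G_def split: split_indicator)
    qed simp
  qed
  also have "\<dots> = (\<integral>\<^sup>+t. (\<integral>\<^sup>+x. ennreal (t powr q) * indicator {0..1} t * G (t *\<^sub>R x) \<partial>lborel) \<partial>lborel)"
    by (rule lborel_pair.Fubini') measurable
  also have "\<dots> = (\<integral>\<^sup>+t. ennreal (t powr (q - n)) * indicator {0..1} t * H \<partial>lborel)"
  proof (rule nn_integral_cong)
    fix t :: real
    show "(\<integral>\<^sup>+x. ennreal (t powr q) * indicator {0..1} t * G (t *\<^sub>R x) \<partial>lborel)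
      = ennreal (t powr (q - n)) * indicator {0..1} t * H"
    \<comment> \<open>The value \<open>t = 0\<close> falls into the trivial case:
      \<open>0 powr a = 0\<close> for every \<open>a\<close>, so both sides vanish.\<close>
    proof (cases "0 < t \<and> t \<le> 1")
      case True
      have "H = ennreal (t ^ n) * (\<integral>\<^sup>+x. G (t *\<^sub>R x) \<partial>lborel)"
        using nn_integral_lborel_scaleR[of G t] True by (simp add: H_def n_def)
      moreover have "t powr (q - n) * t ^ n = t powr q"
        using True by (simp add: powr_diff powr_realpow)
      ultimately have "ennreal (t powr (q - n)) * H = ennreal (t powr q) * (\<integral>\<^sup>+x. G (t *\<^sub>R x) \<partial>lborel)"
        using True by (simp flip: mult.assoc ennreal_mult)
      then show ?thesis
        using True by (simp add: nn_integral_cmult)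
    qed (auto simp: indicator_def)
  qed
  also have "\<dots> = (\<integral>\<^sup>+t. ennreal (t powr (q - n)) * indicator {0..1} t \<partial>lborel) * H"
    by (rule nn_integral_multc) measurable
  also have "(\<integral>\<^sup>+t. ennreal (t powr (q - n)) * indicator {0..1} t \<partial>lborel) = ennreal (1 / (q - n + 1))"
    using q has_integral_powr_from_0[of "q - n" 1]
    by (intro nn_integral_has_integral_lebesgue') (auto simp: n_def)
  finally show ?thesis
    by (simp add: H_def G_def n_def)
qed

text \<open>For a Borel representative \<open>g\<close> both claims are immediate, and
  \<open>f\<close> agrees with \<open>g\<close> at almost every point of almost every ray.\<close>

lemma borel_measurable_rays:
  fixes f :: "'a::euclidean_space \<Rightarrow> real"
  assumes f: "f \<in> borel_measurable (lebesgue_on (ball 0 r))" and w: "w \<in> borel_measurable borel"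
  shows "AE x in lebesgue_on (ball 0 r). (\<lambda>t. w t * f (t *\<^sub>R x)) \<in> borel_measurable (lebesgue_on {0..1})"
    and "(\<lambda>x. LINT t|lebesgue_on {0..1}. w t * f (t *\<^sub>R x)) \<in> borel_measurable (lebesgue_on (ball 0 r))"
proof -
  obtain g where g[measurable]: "g \<in> borel_measurable borel"
      and fg: "AE x in lebesgue_on (ball 0 r). f x = g x"
    using f by (rule lebesgue_on_ex_borel_measurable) auto
  note [measurable] = w
  have gm: "(\<lambda>t. w t * g (t *\<^sub>R x)) \<in> borel_measurable borel" for x
    by measurable
  have gm': "(\<lambda>t. w t * g (t *\<^sub>R x)) \<in> borel_measurable (lebesgue_on {0..1})" for x
    using gm by (simp add: measurable_completion measurable_restrict_space1)
  have ae: "AE x in lebesgue_on (ball 0 r). AE t in lebesgue_on {0..1}. w t * g (t *\<^sub>R x) = w t * f (t *\<^sub>R x)"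
    using AE_lebesgue_on_rays[OF fg] by (auto elim!: eventually_mono)
  show m: "AE x in lebesgue_on (ball 0 r). (\<lambda>t. w t * f (t *\<^sub>R x)) \<in> borel_measurable (lebesgue_on {0..1})"
    using ae by eventually_elim (rule borel_measurable_lebesgue_on_AE[OF gm'], auto)
  show "(\<lambda>x. LINT t|lebesgue_on {0..1}. w t * f (t *\<^sub>R x)) \<in> borel_measurable (lebesgue_on (ball 0 r))"
  proof (rule borel_measurable_lebesgue_on_AE)
    have "(\<lambda>x. LINT t|lborel. indicator {0..1} t * (w t * g (t *\<^sub>R x))) \<in> borel_measurable borel"
      by measurable
    then show "(\<lambda>x. LINT t|lebesgue_on {0..1}. w t * g (t *\<^sub>R x)) \<in> borel_measurable (lebesgue_on (ball 0 r))"
      by (simp add: integral_lebesgue_on_eq_lborel gm measurable_completion measurable_restrict_space1)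
    show "AE x in lebesgue_on (ball 0 r). (LINT t|lebesgue_on {0..1}. w t * g (t *\<^sub>R x))
        = (LINT t|lebesgue_on {0..1}. w t * f (t *\<^sub>R x))"
      using ae m by eventually_elim (intro integral_cong_AE gm')
  qed simp
qed

text \<open>A Borel representative satisfies the Tonelli bound, which is the second claim. Its right
  side is finite, so the inner integral is finite for almost every \<open>x\<close>, which gives the
  first.\<close>

lemma integrable_rays:
  fixes f :: "'a::euclidean_space \<Rightarrow> real"
  assumes f: "integrable (lebesgue_on (ball 0 r)) f" and nonneg: "\<And>x. 0 \<le> f x"
    and q: "q > real DIM('a) - 1"
  shows "AE x in lebesgue_on (ball 0 r). integrable (lebesgue_on {0..1}) (\<lambda>t. t powr q * f (t *\<^sub>R x))"
    and "(\<integral>\<^sup>+x. (\<integral>\<^sup>+t. ennreal (t powr q * f (t *\<^sub>R x)) \<partial>lebesgue_on {0..1}) \<partial>lebesgue_on (ball 0 r))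
      \<le> ennreal ((LINT x|lebesgue_on (ball 0 r). f x) / (q - real DIM('a) + 1))"
proof -
  obtain g where g[measurable]: "g \<in> borel_measurable borel"
      and fg: "AE x in lebesgue_on (ball 0 r). f x = g x"
    using borel_measurable_integrable[OF f] by (rule lebesgue_on_ex_borel_measurable) auto
  have m: "AE x in lebesgue_on (ball 0 r). (\<lambda>t. t powr q * f (t *\<^sub>R x)) \<in> borel_measurable (lebesgue_on {0..1})"
    by (rule borel_measurable_rays) (use f in auto)
  have ae: "AE x in lebesgue_on (ball 0 r). (\<integral>\<^sup>+t. ennreal (t powr q * f (t *\<^sub>R x)) \<partial>lebesgue_on {0..1})
     = (\<integral>\<^sup>+t. ennreal (t powr q) * ennreal (g (t *\<^sub>R x)) * indicator {0..1} t \<partial>lborel)"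
    using AE_lebesgue_on_rays[OF fg]
  proof eventually_elim
    case (elim x)
    have "(\<integral>\<^sup>+t. ennreal (t powr q * f (t *\<^sub>R x)) \<partial>lebesgue_on {0..1})
      = (\<integral>\<^sup>+t. ennreal (t powr q) * ennreal (g (t *\<^sub>R x)) \<partial>lebesgue_on {0..1})"
      using elim by (intro nn_integral_cong_AE) (auto elim!: eventually_mono simp: ennreal_mult' nonneg)
    also have "\<dots> = (\<integral>\<^sup>+t. ennreal (t powr q) * ennreal (g (t *\<^sub>R x)) * indicator {0..1} t \<partial>lborel)"
      by (rule nn_integral_lebesgue_on_eq_lborel) measurable
    finally show ?case .
  qed
  have "(\<integral>\<^sup>+x. ennreal (g x) * indicator (ball 0 r) x \<partial>lborel) = (\<integral>\<^sup>+x. ennreal (g x) \<partial>lebesgue_on (ball 0 r))"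
    by (rule nn_integral_lebesgue_on_eq_lborel[symmetric]) measurable
  also have "\<dots> = (\<integral>\<^sup>+x. ennreal (f x) \<partial>lebesgue_on (ball 0 r))"
    using fg by (intro nn_integral_cong_AE) (auto elim!: eventually_mono)
  also have "\<dots> = ennreal (LINT x|lebesgue_on (ball 0 r). f x)"
    using f by (rule nn_integral_eq_integral) (simp add: nonneg)
  finally have F: "(\<integral>\<^sup>+x. ennreal (g x) * indicator (ball 0 r) x \<partial>lborel)
    = ennreal (LINT x|lebesgue_on (ball 0 r). f x)" .
  define K where "K x = (\<integral>\<^sup>+t. ennreal (t powr q) * ennreal (g (t *\<^sub>R x)) * indicator {0..1} t \<partial>lborel)" for x
  have K[measurable]: "K \<in> borel_measurable borel"
    unfolding K_def by measurable
  have "(\<integral>\<^sup>+x. K x \<partial>lebesgue_on (ball 0 r)) = (\<integral>\<^sup>+x. K x * indicator (ball 0 r) x \<partial>lborel)"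
    by (rule nn_integral_lebesgue_on_eq_lborel) measurable
  also have "\<dots> \<le> ennreal (1 / (q - real DIM('a) + 1)) * ennreal (LINT x|lebesgue_on (ball 0 r). f x)"
    using nn_integral_rays_le[of "\<lambda>x. ennreal (g x)" q r] q unfolding F K_def by simp
  also have "\<dots> = ennreal ((LINT x|lebesgue_on (ball 0 r). f x) / (q - real DIM('a) + 1))"
    using q nonneg by (simp flip: ennreal_mult)
  finally have bound: "(\<integral>\<^sup>+x. K x \<partial>lebesgue_on (ball 0 r))
    \<le> ennreal ((LINT x|lebesgue_on (ball 0 r). f x) / (q - real DIM('a) + 1))" .
  then show "(\<integral>\<^sup>+x. (\<integral>\<^sup>+t. ennreal (t powr q * f (t *\<^sub>R x)) \<partial>lebesgue_on {0..1}) \<partial>lebesgue_on (ball 0 r))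
      \<le> ennreal ((LINT x|lebesgue_on (ball 0 r). f x) / (q - real DIM('a) + 1))"
    using nn_integral_cong_AE[OF ae] by (simp add: K_def)
  have "AE x in lebesgue_on (ball 0 r). K x \<noteq> \<infinity>"
  proof (rule nn_integral_PInf_AE)
    show "K \<in> borel_measurable (lebesgue_on (ball 0 r))"
      using K by (simp add: measurable_completion measurable_restrict_space1)
    show "(\<integral>\<^sup>+x. K x \<partial>lebesgue_on (ball 0 r)) \<noteq> \<infinity>"
      using bound by (auto simp: top_unique)
  qed
  then show "AE x in lebesgue_on (ball 0 r). integrable (lebesgue_on {0..1}) (\<lambda>t. t powr q * f (t *\<^sub>R x))"
    using m ae
  proof eventually_elim
    case (elim x)
    then show ?case
      by (auto intro!: integrableI_nonneg simp: nonneg K_def less_top)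
  qed
qed

section \<open>Jensen's inequality for powers\<close>

lemma powr_integral_le_integral_powr:
  fixes h :: "'a \<Rightarrow> real"
  assumes M: "finite_measure M" "measure M (space M) = 1" and p: "p \<ge> 1"
    and h: "h \<in> borel_measurable M" "\<And>x. x \<in> space M \<Longrightarrow> 0 \<le> h x" and hp: "integrable M (\<lambda>x. h x powr p)"
  shows "integrable M h" "(LINT x|M. h x) powr p \<le> (LINT x|M. h x powr p)"
proof -
  interpret finite_measure M by fact
  \<comment> \<open>Constants are integrable on a finite measure space, so this pointwise bound
    makes \<open>h\<close> integrable.\<close>
  have "h x \<le> 1 + h x powr p" for x
  proof (cases "h x \<le> 1")
    case False
    then have "h x powr 1 \<le> h x powr p" using p by (intro powr_mono) auto
    then show ?thesis using False by simp
  qed (simp add: add_increasing2)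
  then show int: "integrable M h"
    using h hp
    by (intro Bochner_Integration.integrable_bound[of M "\<lambda>x. 1 + h x powr p" h])
       (auto intro!: AE_I2)
  define m where "m = (LINT x|M. h x)"
  have m: "m \<ge> 0" unfolding m_def using h by (intro integral_nonneg_AE AE_I2)
  \<comment> \<open>the graph of \<open>h powr p\<close> lies above its tangent at the mean \<open>m\<close>\<close>
  have tangent: "p * m powr (p - 1) * h x - (p - 1) * m powr p \<le> h x powr p" if "m > 0" "x \<in> space M" for x
  proof (cases "h x = 0")
    case True
    then show ?thesis using p that by simp
  next
    case False
    then have "h x > 0" using h(2)[of x] that by simp
    \<comment> \<open>Young's inequality for \<open>h x powr p\<close> and \<open>m powr p\<close>
      with weights \<open>1/p\<close> and \<open>1 - 1/p\<close> is the tangent inequality divided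
      by \<open>p\<close>.\<close>
    then have "(h x powr p) powr (1/p) * (m powr p) powr (1 - 1/p) \<le> (1/p) * h x powr p + (1 - 1/p) * m powr p"
      using that(1) p by (intro Youngs_inequality_0) auto
    moreover have "(h x powr p) powr (1/p) = h x" "(m powr p) powr (1 - 1/p) = m powr (p - 1)"
      using \<open>h x > 0\<close> p by (simp_all add: powr_powr right_diff_distrib)
    ultimately have "p * (h x * m powr (p - 1)) \<le> p * ((1/p) * h x powr p + (1 - 1/p) * m powr p)"
      using p by (intro mult_left_mono) auto
    also have "\<dots> = h x powr p + (p - 1) * m powr p"
      using p by (simp add: field_simps)
    finally show ?thesis by (simp add: mult_ac)
  qed
  show "(LINT x|M. h x) powr p \<le> (LINT x|M. h x powr p)"
  \<comment> \<open>The tangent bound needs \<open>m > 0\<close>; at mean zero the left side is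
    \<open>0 powr p = 0\<close>.\<close>
  proof (cases "m = 0")
    case True
    then show ?thesis using h hp by (simp flip: m_def)
  next
    case False
    then have "m > 0" using m by simp
    \<comment> \<open>The tangent line takes the value \<open>m powr p\<close> at \<open>m\<close>,
      and since the total mass is 1, integrating it amounts to inserting the mean.\<close>
    have "m powr p = p * m powr (p - 1) * m - (p - 1) * m powr p"
      using \<open>m > 0\<close> by (simp add: powr_diff field_simps)
    also have "\<dots> = (LINT x|M. p * m powr (p - 1) * h x - (p - 1) * m powr p)"
      using int M(2) by (simp add: m_def)
    also have "\<dots> \<le> (LINT x|M. h x powr p)"
      using int hp tangent[OF \<open>m > 0\<close>] by (intro integral_mono) auto
    finally show ?thesis by (simp add: m_def)
  qed
qed

section \<open>The operator \<open>S\<close>\<close>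

text \<open>Here \<open>x\<close> only selects the ray. The slot that \<open>S_op\<close> fills with
  \<open>x\<close> stays free, so that the result can be an alternating \<open>k\<close>-form to be
  contracted with \<open>x\<close>.\<close>

definition ray_integral :: "nat \<Rightarrow> 'n::{finite,linorder} diff_form \<Rightarrow> 'n diff_form" where
  "ray_integral k \<omega> x vs = (LINT t|lebesgue_on {0..1}. t ^ (k - 1) * \<omega> (t *\<^sub>R x) vs)"

text \<open>These are the properties of \<open>\<omega>\<close> along one ray that make
  \<open>S_op\<close> meaningful and bounded at \<open>x\<close>. The algebra and Jensen's
  inequality then work at a fixed point, and almost-everywhere arguments only have to show that
  almost every point qualifies.\<close>

definition ray_regular :: "nat \<Rightarrow> real \<Rightarrow> 'n::{finite,linorder} diff_form \<Rightarrow> (real, 'n) vec \<Rightarrow> bool" where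
  "ray_regular k p \<omega> x \<longleftrightarrow>
     (AE t in lebesgue_on {0..1}. alternating_multilinear k (\<omega> (t *\<^sub>R x))) \<and>
     (\<forall>js\<in>multi_indices k. (\<lambda>t. t ^ (k - 1) * form_coeff \<omega> js (t *\<^sub>R x)) \<in> borel_measurable (lebesgue_on {0..1})) \<and>
     integrable (lebesgue_on {0..1}) (\<lambda>t. (t ^ (k - 1) * form_modulus k \<omega> (t *\<^sub>R x)) powr p)"

lemma S_op_eq_ray_integral: "S_op k \<omega> x \<xi>s = ray_integral k \<omega> x (x # \<xi>s)"
  by (simp add: S_op_def ray_integral_def S_integrand_def set_lebesgue_integral_def integral_restrict_space)

lemma set_integrable_S_integrand_iff:
  "set_integrable lebesgue {0..1} (S_integrand k \<omega> x \<xi>s)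
    \<longleftrightarrow> integrable (lebesgue_on {0..1}) (\<lambda>t. t ^ (k - 1) * \<omega> (t *\<^sub>R x) (x # \<xi>s))"
  by (simp add: S_integrand_def set_integrable_def integrable_restrict_space)

lemma form_modulus_nonneg [simp]: "0 \<le> form_modulus k \<omega> x"
  by (simp add: form_modulus_def sum_nonneg)

lemma abs_form_coeff_le_form_modulus:
  "js \<in> multi_indices k \<Longrightarrow> \<bar>form_coeff \<omega> js x\<bar> \<le> form_modulus k \<omega> x"
  using member_le_L2_set[of "multi_indices k" js "\<lambda>js. \<bar>form_coeff \<omega> js x\<bar>"]
  by (simp add: form_modulus_def L2_set_def)

text \<open>Cauchy--Schwarz against the constant 1; the number of multi-indices supplies the
  binomial coefficient.\<close>

lemma sum_form_coeff_le_form_modulus: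
  fixes \<omega> :: "'n::{finite,linorder} diff_form"
  shows "(\<Sum>js\<in>multi_indices k. \<bar>form_coeff \<omega> js x\<bar>) \<le> sqrt (real (CARD('n) choose k)) * form_modulus k \<omega> x"
  using L2_set_mult_ineq[of "\<lambda>_. 1" "\<lambda>js. form_coeff \<omega> js x" "multi_indices k"]
  by (simp add: form_modulus_def L2_set_def card_multi_indices)

lemma borel_measurable_form_modulus:
  assumes "\<And>js. js \<in> multi_indices k \<Longrightarrow> form_coeff \<omega> js \<in> borel_measurable M"
  shows "form_modulus k \<omega> \<in> borel_measurable M"
  using assms unfolding form_modulus_def[abs_def] by measurable

section \<open>Estimates at a point with a regular ray\<close>

lemma finite_measure_lebesgue_on_unit: "finite_measure (lebesgue_on {0..1::real})"
  by (rule finite_measureI) (simp add: emeasure_restrict_space)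

lemma integrable_form_modulus_ray:
  assumes "ray_regular k p \<omega> x" "p \<ge> 1"
  shows "integrable (lebesgue_on {0..1}) (\<lambda>t. t ^ (k - 1) * form_modulus k \<omega> (t *\<^sub>R x))"
    and "(LINT t|lebesgue_on {0..1}. t ^ (k - 1) * form_modulus k \<omega> (t *\<^sub>R x)) powr p
      \<le> (LINT t|lebesgue_on {0..1}. (t ^ (k - 1) * form_modulus k \<omega> (t *\<^sub>R x)) powr p)"
proof -
  have sqrt_sum: "(\<lambda>t. sqrt (\<Sum>j\<in>J. (F j t)\<^sup>2)) \<in> borel_measurable M"
    if "\<And>j. j \<in> J \<Longrightarrow> F j \<in> borel_measurable M" for F :: "'b \<Rightarrow> 'c \<Rightarrow> real" and J M
    using that by measurable
  have "(\<lambda>t. sqrt (\<Sum>js\<in>multi_indices k. (t ^ (k - 1) * form_coeff \<omega> js (t *\<^sub>R x))\<^sup>2))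
      \<in> borel_measurable (lebesgue_on {0..1})"
    using assms(1) by (intro sqrt_sum) (simp add: ray_regular_def)
  \<comment> \<open>On \<open>[0, 1]\<close> the weight \<open>t ^ (k - 1)\<close> is nonnegative
    and comes out of the root.\<close>
  also have "?this \<longleftrightarrow> (\<lambda>t. t ^ (k - 1) * form_modulus k \<omega> (t *\<^sub>R x)) \<in> borel_measurable (lebesgue_on {0..1})"
    by (rule measurable_cong)
       (auto simp: form_modulus_def power_mult_distrib real_sqrt_mult simp flip: sum_distrib_left)
  finally have meas: "(\<lambda>t. t ^ (k - 1) * form_modulus k \<omega> (t *\<^sub>R x)) \<in> borel_measurable (lebesgue_on {0..1})" .
  have "measure (lebesgue_on {0..1::real}) (space (lebesgue_on {0..1})) = 1"
    by (simp add: measure_restrict_space)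
  note * = powr_integral_le_integral_powr[OF finite_measure_lebesgue_on_unit this assms(2) meas]
  show "integrable (lebesgue_on {0..1}) (\<lambda>t. t ^ (k - 1) * form_modulus k \<omega> (t *\<^sub>R x))"
    and "(LINT t|lebesgue_on {0..1}. t ^ (k - 1) * form_modulus k \<omega> (t *\<^sub>R x)) powr p
      \<le> (LINT t|lebesgue_on {0..1}. (t ^ (k - 1) * form_modulus k \<omega> (t *\<^sub>R x)) powr p)"
    using assms(1) by (intro *; simp add: ray_regular_def)+
qed

text \<open>On basis vectors the integrand is a weighted coefficient, dominated by the weighted
  modulus, which is integrable along the ray; multilinearity extends this to arbitrary
  vectors.\<close>

lemma integrable_ray:
  assumes reg: "ray_regular k p \<omega> x" and p: "p \<ge> 1" and vs: "length vs = k"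
  shows "integrable (lebesgue_on {0..1}) (\<lambda>t. t ^ (k - 1) * \<omega> (t *\<^sub>R x) vs)"
proof (rule integrable_alternating_multilinear[OF _ _ _ vs])
  show "AE t in lebesgue_on {0..1}. alternating_multilinear k (\<omega> (t *\<^sub>R x))"
    using reg by (simp add: ray_regular_def)
  fix js :: "'a list"
  assume js: "js \<in> multi_indices k"
  show "integrable (lebesgue_on {0..1}) (\<lambda>t. t ^ (k - 1) * \<omega> (t *\<^sub>R x) (basis_list js))"
  proof (rule Bochner_Integration.integrable_bound[OF integrable_form_modulus_ray(1)[OF reg p]])
    show "(\<lambda>t. t ^ (k - 1) * \<omega> (t *\<^sub>R x) (basis_list js)) \<in> borel_measurable (lebesgue_on {0..1})"
      using reg js by (simp add: ray_regular_def form_coeff_def)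
    show "AE t in lebesgue_on {0..1}. norm (t ^ (k - 1) * \<omega> (t *\<^sub>R x) (basis_list js))
        \<le> norm (t ^ (k - 1) * form_modulus k \<omega> (t *\<^sub>R x))"
      using abs_form_coeff_le_form_modulus[OF js, of \<omega>]
      by (intro AE_I2) (simp add: abs_mult mult_left_mono form_coeff_def)
  qed
qed simp

lemma alternating_multilinear_ray_integral:
  assumes "ray_regular k p \<omega> x" "p \<ge> 1"
  shows "alternating_multilinear k (ray_integral k \<omega> x)"
  unfolding ray_integral_def[abs_def]
  using assms integrable_ray[OF assms]
  by (intro alternating_multilinear_integral) (auto simp: ray_regular_def)

lemma alternating_multilinear_S_op:
  assumes "ray_regular k p \<omega> x" "p \<ge> 1" "k \<ge> 1"
  shows "alternating_multilinear (k - 1) (S_op k \<omega> x)"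
  using alternating_multilinear_interior_product[of "k - 1" "ray_integral k \<omega> x" x]
    alternating_multilinear_ray_integral[OF assms(1,2)] assms(3)
  by (simp add: S_op_eq_ray_integral[abs_def])

text \<open>The contraction estimate is applied to the ray integral and absolute values move under
  the integral. Cauchy--Schwarz turns the sum of coefficients into the modulus, and Jensen's
  inequality moves the power \<open>p\<close> inside.\<close>

lemma form_modulus_S_op_le:
  fixes x :: "(real, 'n::{finite,linorder}) vec"
  assumes reg: "ray_regular k p \<omega> x" and p: "p \<ge> 1" and k: "k \<ge> 1"
  shows "form_modulus (k - 1) (S_op k \<omega>) x powr p
    \<le> (norm x * sqrt (real (CARD('n) choose k))) powr p
      * (LINT t|lebesgue_on {0..1}. (t ^ (k - 1) * form_modulus k \<omega> (t *\<^sub>R x)) powr p)"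
proof -
  let ?L = "lebesgue_on {0..1::real}" and ?m = "\<lambda>t. t ^ (k - 1) * form_modulus k \<omega> (t *\<^sub>R x)"
  let ?f = "\<lambda>js t. t ^ (k - 1) * form_coeff \<omega> js (t *\<^sub>R x)"
  let ?C = "sqrt (real (CARD('n) choose k))"
  have f: "integrable ?L (?f js)" if "js \<in> multi_indices k" for js
    using integrable_ray[OF reg p, of "basis_list js"] that
    by (simp add: multi_indices_def form_coeff_def)
  have "form_modulus (k - 1) (S_op k \<omega>) x
      = L2_set (\<lambda>is. ray_integral k \<omega> x (x # basis_list is)) (multi_indices (k - 1))"
    by (simp add: form_modulus_def L2_set_def form_coeff_def S_op_eq_ray_integral)
  also have "\<dots> \<le> norm x * (\<Sum>js\<in>multi_indices k. \<bar>ray_integral k \<omega> x (basis_list js)\<bar>)"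
    using interior_product_modulus_le[of "k - 1" "ray_integral k \<omega> x" x] k
      alternating_multilinear_ray_integral[OF reg p] by simp
  also have "\<dots> \<le> norm x * (\<Sum>js\<in>multi_indices k. (LINT t|?L. \<bar>?f js t\<bar>))"
    by (intro mult_left_mono sum_mono)
       (auto simp: ray_integral_def form_coeff_def intro: integral_abs_bound)
  also have "\<dots> = norm x * (LINT t|?L. (\<Sum>js\<in>multi_indices k. \<bar>?f js t\<bar>))"
    using f by (subst Bochner_Integration.integral_sum) auto
  also have "\<dots> \<le> norm x * (LINT t|?L. ?C * ?m t)"
  proof (intro mult_left_mono integral_mono)
    fix t :: real
    assume "t \<in> space ?L"
    then have "t ^ (k - 1) * (\<Sum>js\<in>multi_indices k. \<bar>form_coeff \<omega> js (t *\<^sub>R x)\<bar>)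
      \<le> t ^ (k - 1) * (?C * form_modulus k \<omega> (t *\<^sub>R x))"
      by (intro mult_left_mono sum_form_coeff_le_form_modulus) simp
    then show "(\<Sum>js\<in>multi_indices k. \<bar>?f js t\<bar>) \<le> ?C * ?m t"
      using \<open>t \<in> space ?L\<close> by (simp add: abs_mult sum_distrib_left mult_ac)
  qed (use f integrable_form_modulus_ray(1)[OF reg p] in auto)
  also have "\<dots> = norm x * ?C * (LINT t|?L. ?m t)"
    by simp
  finally have "form_modulus (k - 1) (S_op k \<omega>) x powr p \<le> (norm x * ?C * (LINT t|?L. ?m t)) powr p"
    using p by (intro powr_mono2) auto
  also have "\<dots> = (norm x * ?C) powr p * (LINT t|?L. ?m t) powr p"
    by (rule powr_mult)
  also have "\<dots> \<le> (norm x * ?C) powr p * (LINT t|?L. ?m t powr p)"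
    using integrable_form_modulus_ray(2)[OF reg p] by (intro mult_left_mono) auto
  finally show ?thesis .
qed

section \<open>Almost every ray and the integral bound\<close>

lemma scaled_form_modulus_powr:
  fixes t :: real
  assumes "t \<ge> 0" "k \<ge> 2"
  shows "(t ^ (k - 1) * form_modulus k \<omega> y) powr p = t powr (p * (real k - 1)) * form_modulus k \<omega> y powr p"
\<comment> \<open>At \<open>t = 0\<close> both sides are 0: \<open>k - 1\<close> is positive, so
  \<open>0 ^ (k - 1) = 0\<close>, and \<open>0 powr a = 0\<close> for every \<open>a\<close>. For
  \<open>k = 1\<close> the left side would contain \<open>0 ^ 0 = 1\<close>.\<close>
proof (cases "t = 0")
  case False
  then have "t ^ (k - 1) = t powr (real k - 1)"
    using assms by (simp add: of_nat_diff flip: powr_realpow)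
  then show ?thesis
    using assms by (simp add: powr_mult powr_powr mult.commute)
qed (use assms in \<open>simp add: zero_power\<close>)

text \<open>Alternation passes to almost every ray, measurability does so for each of the finitely
  many multi-indices, and integrability comes from the ray bound with exponent
  \<open>q = p * (real k - 1)\<close>, which \<open>pk\<close> makes large enough.\<close>

lemma AE_ray_regular:
  fixes \<omega> :: "'n::{finite,linorder} diff_form"
  assumes \<omega>: "\<omega> \<in> Omega k p r" and k: "k \<ge> 2" and pk: "p * (real k - 1) > real CARD('n) - 1"
  shows "AE x in lebesgue_on (ball 0 r). ray_regular k p \<omega> x"
proof -
  have "AE x in lebesgue_on (ball 0 r). AE t in lebesgue_on {0..1}. alternating_multilinear k (\<omega> (t *\<^sub>R x))"
    using \<omega> by (intro AE_lebesgue_on_rays) (simp add: Omega_def)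
  moreover have "AE x in lebesgue_on (ball 0 r). \<forall>js\<in>multi_indices k.
      (\<lambda>t. t ^ (k - 1) * form_coeff \<omega> js (t *\<^sub>R x)) \<in> borel_measurable (lebesgue_on {0..1})"
    using \<omega> by (intro AE_finite_allI borel_measurable_rays(1)) (auto simp: Omega_def)
  moreover have "AE x in lebesgue_on (ball 0 r). integrable (lebesgue_on {0..1})
      (\<lambda>t. t powr (p * (real k - 1)) * form_modulus k \<omega> (t *\<^sub>R x) powr p)"
    using \<omega> pk by (intro integrable_rays(1)) (auto simp: Omega_def)
  ultimately show ?thesis
  proof eventually_elim
    case (elim x)
    moreover have "integrable (lebesgue_on {0..1}) (\<lambda>t. (t ^ (k - 1) * form_modulus k \<omega> (t *\<^sub>R x)) powr p)
      \<longleftrightarrow> integrable (lebesgue_on {0..1}) (\<lambda>t. t powr (p * (real k - 1)) * form_modulus k \<omega> (t *\<^sub>R x) powr p)"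
      by (rule Bochner_Integration.integrable_cong) (auto simp: scaled_form_modulus_powr[OF _ k, simplified])
    ultimately show ?case
      by (simp add: ray_regular_def)
  qed
qed

text \<open>The point \<open>x\<close> enters both the ray and a slot of the form. The contraction
  formula separates the two: almost everywhere the coefficient is a sum of coordinates of
  \<open>x\<close>, with signs not depending on \<open>x\<close>, times ray integrals of
  coefficients of \<open>\<omega>\<close>.\<close>

lemma borel_measurable_form_coeff_S_op:
  fixes \<omega> :: "'n::{finite,linorder} diff_form"
  assumes \<omega>: "\<omega> \<in> Omega k p r" and p: "p \<ge> 1" and k: "k \<ge> 2" and pk: "p * (real k - 1) > real CARD('n) - 1"
    and "is": "is \<in> multi_indices (k - 1)"
  shows "form_coeff (S_op k \<omega>) is \<in> borel_measurable (lebesgue_on (ball 0 r))"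
proof -
  obtain s :: "'n list \<Rightarrow> real" where "\<And>js. \<bar>s js\<bar> = 1" and s:
    "\<And>k \<phi> x is. alternating_multilinear (Suc k) \<phi> \<Longrightarrow> length is = k
      \<Longrightarrow> \<phi> (x # basis_list is) = (\<Sum>js\<in>multi_indices (Suc k).
        (\<Sum>j\<in>{j. sort (j # is) = js}. x $ j * s (j # is)) * \<phi> (basis_list js))"
    using interior_product_basis by blast
  let ?g = "\<lambda>x. \<Sum>js\<in>multi_indices k. (\<Sum>j\<in>{j. sort (j # is) = js}. x $ j * s (j # is))
    * ray_integral k \<omega> x (basis_list js)"
  have ray_meas: "(\<lambda>x. ray_integral k \<omega> x (basis_list js)) \<in> borel_measurable (lebesgue_on (ball 0 r))"
    if "js \<in> multi_indices k" for js
    using \<omega> that borel_measurable_rays(2)[of "form_coeff \<omega> js" r "\<lambda>t. t ^ (k - 1)"]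
    by (auto simp: Omega_def ray_integral_def[abs_def] form_coeff_def[abs_def])
  have comp_meas: "(\<lambda>x::(real, 'n) vec. x $ j) \<in> borel_measurable (lebesgue_on (ball 0 r))" for j
    by (intro measurable_restrict_space1 measurable_completion) (simp add: borel_measurable_continuous_onI continuous_on_component)
  have "?g \<in> borel_measurable (lebesgue_on (ball 0 r))"
    by (intro borel_measurable_sum borel_measurable_times borel_measurable_const ray_meas comp_meas)
  moreover have "AE x in lebesgue_on (ball 0 r). ?g x = form_coeff (S_op k \<omega>) is x"
    using AE_ray_regular[OF \<omega> k pk]
  proof eventually_elim
    case (elim x)
    have "alternating_multilinear (Suc (k - 1)) (ray_integral k \<omega> x)"
      using alternating_multilinear_ray_integral[OF elim p] k by simp
    from s[OF this, of "is" x] show ?case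
      using "is" k by (simp add: multi_indices_def form_coeff_def S_op_eq_ray_integral del: sort_key_simps)
  qed
  ultimately show ?thesis
    by (rule borel_measurable_lebesgue_on_AE) simp
qed

text \<open>The pointwise estimate, with \<open>norm x\<close> replaced by \<open>r\<close> inside
  the ball, is integrated by means of the ray bound.\<close>

lemma S_op_integral_bound:
  fixes \<omega> :: "'n::{finite,linorder} diff_form"
  assumes \<omega>: "\<omega> \<in> Omega k p r" and p: "p \<ge> 1" and k: "k \<ge> 2" and pk: "p * (real k - 1) > real CARD('n) - 1"
    and r: "r > 0"
  shows "integrable (lebesgue_on (ball 0 r)) (\<lambda>x. form_modulus (k - 1) (S_op k \<omega>) x powr p)"
    and "(LINT x|lebesgue_on (ball 0 r). form_modulus (k - 1) (S_op k \<omega>) x powr p)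
      \<le> (r * sqrt (real (CARD('n) choose k))) powr p / (p * (real k - 1) - real CARD('n) + 1)
        * (LINT x|lebesgue_on (ball 0 r). form_modulus k \<omega> x powr p)"
proof -
  define C where "C = (r * sqrt (real (CARD('n) choose k))) powr p"
  define q where "q = p * (real k - 1)"
  \<comment> \<open>With the constant absorbed into \<open>f\<close>, the right side of the
    pointwise estimate is exactly the ray integral of \<open>f\<close>.\<close>
  define f where "f y = C * form_modulus k \<omega> y powr p" for y
  let ?B = "lebesgue_on (ball 0 r) :: (real, 'n) vec measure" and ?L = "lebesgue_on {0..1::real}"
  let ?S = "\<lambda>x. form_modulus (k - 1) (S_op k \<omega>) x powr p"
  have f: "integrable ?B f" "\<And>y. 0 \<le> f y"
    using \<omega> by (auto simp: f_def[abs_def] C_def Omega_def)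
  have q: "q > real DIM((real, 'n) vec) - 1"
    using pk by (simp add: q_def)
  have "form_modulus (k - 1) (S_op k \<omega>) \<in> borel_measurable ?B"
    by (intro borel_measurable_form_modulus borel_measurable_form_coeff_S_op[OF \<omega> p k pk])
  then have meas: "?S \<in> borel_measurable ?B"
    by measurable
  have "AE x in ?B. ennreal (?S x) \<le> (\<integral>\<^sup>+t. ennreal (t powr q * f (t *\<^sub>R x)) \<partial>?L)"
    using AE_ray_regular[OF \<omega> k pk] integrable_rays(1)[OF f q] AE_space
  proof eventually_elim
    case (elim x)
    have "?S x \<le> (norm x * sqrt (real (CARD('n) choose k))) powr p
        * (LINT t|?L. (t ^ (k - 1) * form_modulus k \<omega> (t *\<^sub>R x)) powr p)"
      using form_modulus_S_op_le[OF elim(1) p] k by simp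
    also have "\<dots> \<le> C * (LINT t|?L. (t ^ (k - 1) * form_modulus k \<omega> (t *\<^sub>R x)) powr p)"
      unfolding C_def using elim(3) p by (intro mult_right_mono powr_mono2 integral_nonneg_AE) auto
    also have "\<dots> = (LINT t|?L. t powr q * f (t *\<^sub>R x))"
      unfolding integral_mult_right_zero[symmetric]
      by (rule Bochner_Integration.integral_cong) (auto simp: scaled_form_modulus_powr[OF _ k, simplified] f_def q_def)
    finally have "ennreal (?S x) \<le> ennreal (LINT t|?L. t powr q * f (t *\<^sub>R x))"
      by (rule ennreal_leI)
    also have "\<dots> = (\<integral>\<^sup>+t. ennreal (t powr q * f (t *\<^sub>R x)) \<partial>?L)"
      using elim(2) f(2) by (intro nn_integral_eq_integral[symmetric]) auto
    finally show ?case .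
  qed
  then have "(\<integral>\<^sup>+x. ennreal (?S x) \<partial>?B) \<le> (\<integral>\<^sup>+x. (\<integral>\<^sup>+t. ennreal (t powr q * f (t *\<^sub>R x)) \<partial>?L) \<partial>?B)"
    by (rule nn_integral_mono_AE)
  also have "\<dots> \<le> ennreal ((LINT x|?B. f x) / (q - real DIM((real, 'n) vec) + 1))"
    by (rule integrable_rays(2)[OF f q])
  finally have bound: "(\<integral>\<^sup>+x. ennreal (?S x) \<partial>?B) \<le> ennreal ((LINT x|?B. f x) / (q - real DIM((real, 'n) vec) + 1))" .
  \<comment> \<open>Integrability follows from the finite bound on the nonnegative integral; only
    then can that integral be read as a real one.\<close>
  show int: "integrable ?B ?S"
    using meas bound by (intro integrableI_nonneg) (auto simp: le_less_trans[OF _ ennreal_less_top])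
  have "ennreal (LINT x|?B. ?S x) \<le> ennreal ((LINT x|?B. f x) / (q - real DIM((real, 'n) vec) + 1))"
    using bound nn_integral_eq_integral[OF int] by simp
  moreover have "0 \<le> (LINT x|?B. f x) / (q - real DIM((real, 'n) vec) + 1)"
    using f(2) q by (intro divide_nonneg_nonneg integral_nonneg_AE) auto
  ultimately have "(LINT x|?B. ?S x) \<le> (LINT x|?B. f x) / (q - real DIM((real, 'n) vec) + 1)"
    by simp
  then show "(LINT x|?B. ?S x) \<le> (r * sqrt (real (CARD('n) choose k))) powr p / (p * (real k - 1) - real CARD('n) + 1)
        * (LINT x|?B. form_modulus k \<omega> x powr p)"
    by (simp add: f_def C_def q_def)
qed

section \<open>Action on classes of forms, linearity and norm\<close>

lemma S_op_in_Omega: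
  fixes \<omega> :: "'n::{finite,linorder} diff_form"
  assumes \<omega>: "\<omega> \<in> Omega k p r" and p: "p \<ge> 1" and k: "k \<ge> 2" and pk: "p * (real k - 1) > real CARD('n) - 1"
    and r: "r > 0"
  shows "S_op k \<omega> \<in> Omega (k - 1) p r"
proof -
  have "AE x in lebesgue_on (ball 0 r). alternating_multilinear (k - 1) (S_op k \<omega> x)"
    using AE_ray_regular[OF \<omega> k pk]
    by eventually_elim (rule alternating_multilinear_S_op, use p k in auto)
  then show ?thesis
    using borel_measurable_form_coeff_S_op[OF \<omega> p k pk] S_op_integral_bound(1)[OF assms]
    by (simp add: Omega_def)
qed

text \<open>Almost everywhere equality on the ball passes to almost every ray, where the two
  integrands agree for almost every \<open>t\<close>.\<close>

lemma S_op_AE_cong: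
  fixes \<omega> \<eta> :: "'n::{finite,linorder} diff_form"
  assumes "\<omega> \<in> Omega k p r" "\<eta> \<in> Omega k p r" and p: "p \<ge> 1" and k: "k \<ge> 2"
    and pk: "p * (real k - 1) > real CARD('n) - 1" and eq: "form_AE_eq k r \<omega> \<eta>"
  shows "form_AE_eq (k - 1) r (S_op k \<omega>) (S_op k \<eta>)"
  unfolding form_AE_eq_def
  using AE_ray_regular[OF assms(1) k pk] AE_ray_regular[OF assms(2) k pk]
    AE_lebesgue_on_rays[OF eq[unfolded form_AE_eq_def]]
proof eventually_elim
  case (elim x)
  show ?case
  proof (intro allI impI)
    fix vs :: "(real, 'n) vec list"
    assume "length vs = k - 1"
    then have len: "length (x # vs) = k" using k by simp
    show "S_op k \<omega> x vs = S_op k \<eta> x vs"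
      unfolding S_op_eq_ray_integral ray_integral_def
    proof (rule integral_cong_AE)
      show "AE t in lebesgue_on {0..1}. t ^ (k - 1) * \<omega> (t *\<^sub>R x) (x # vs) = t ^ (k - 1) * \<eta> (t *\<^sub>R x) (x # vs)"
        using elim(3) by eventually_elim (use len in simp)
    qed (intro borel_measurable_integrable integrable_ray[OF _ p len] elim)+
  qed
qed

text \<open>Splitting the integral requires both parts to be integrable, which holds on rays regular
  for both forms; this is why the identity is claimed almost everywhere only.\<close>

lemma S_op_linear:
  fixes \<omega> \<eta> :: "'n::{finite,linorder} diff_form"
  assumes "\<omega> \<in> Omega k p r" "\<eta> \<in> Omega k p r" and p: "p \<ge> 1" and k: "k \<ge> 2"
    and pk: "p * (real k - 1) > real CARD('n) - 1"
  shows "form_AE_eq (k - 1) r (S_op k (\<lambda>x vs. a * \<omega> x vs + b * \<eta> x vs))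
    (\<lambda>x \<xi>s. a * S_op k \<omega> x \<xi>s + b * S_op k \<eta> x \<xi>s)"
  unfolding form_AE_eq_def
  using AE_ray_regular[OF assms(1) k pk] AE_ray_regular[OF assms(2) k pk]
proof eventually_elim
  case (elim x)
  show ?case
  proof (intro allI impI)
    fix vs :: "(real, 'n) vec list"
    assume "length vs = k - 1"
    then have len: "length (x # vs) = k" using k by simp
    have "(LINT t|lebesgue_on {0..1}. t ^ (k - 1) * (a * \<omega> (t *\<^sub>R x) (x # vs) + b * \<eta> (t *\<^sub>R x) (x # vs)))
      = (LINT t|lebesgue_on {0..1}. a * (t ^ (k - 1) * \<omega> (t *\<^sub>R x) (x # vs)) + b * (t ^ (k - 1) * \<eta> (t *\<^sub>R x) (x # vs)))"
      by (simp add: algebra_simps)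
    also have "\<dots> = a * (LINT t|lebesgue_on {0..1}. t ^ (k - 1) * \<omega> (t *\<^sub>R x) (x # vs))
      + b * (LINT t|lebesgue_on {0..1}. t ^ (k - 1) * \<eta> (t *\<^sub>R x) (x # vs))"
      using integrable_ray[OF elim(1) p len] integrable_ray[OF elim(2) p len] by simp
    finally show "S_op k (\<lambda>x vs. a * \<omega> x vs + b * \<eta> x vs) x vs = a * S_op k \<omega> x vs + b * S_op k \<eta> x vs"
      by (simp add: S_op_eq_ray_integral ray_integral_def)
  qed
qed

lemma Omega_norm_S_op_le:
  fixes \<omega> :: "'n::{finite,linorder} diff_form"
  assumes \<omega>: "\<omega> \<in> Omega k p r" and p: "p \<ge> 1" and k: "k \<ge> 2" and pk: "p * (real k - 1) > real CARD('n) - 1"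
    and r: "r > 0"
  shows "Omega_norm (k - 1) p r (S_op k \<omega>)
    \<le> r * sqrt (real (CARD('n) choose k)) / (p * (real k - 1) - real CARD('n) + 1) powr (1 / p)
      * Omega_norm k p r \<omega>"
proof -
  let ?D = "p * (real k - 1) - real CARD('n) + 1" and ?c = "r * sqrt (real (CARD('n) choose k))"
  let ?I = "LINT x|lebesgue_on (ball 0 r). form_modulus k \<omega> x powr p"
  have "Omega_norm (k - 1) p r (S_op k \<omega>) \<le> (?c powr p / ?D * ?I) powr (1 / p)"
    unfolding Omega_norm_def using p S_op_integral_bound(2)[OF assms]
    by (intro powr_mono2) auto
  also have "\<dots> = (?c powr p / ?D) powr (1 / p) * ?I powr (1 / p)"
    by (rule powr_mult)
  \<comment> \<open>The root cancels the power \<open>p\<close> because \<open>r > 0\<close> makes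
    \<open>?c\<close> nonnegative, and \<open>pk\<close> makes \<open>?D\<close> positive.\<close>
  also have "(?c powr p / ?D) powr (1 / p) = ?c / ?D powr (1 / p)"
    using p r pk by (simp add: powr_divide powr_powr)
  finally show ?thesis
    by (simp add: Omega_norm_def)
qed

text \<open>Since \<open>Omega\<close> consists of representatives, a well-defined operator on
  classes requires existence of the integral, a result that is again a representative, and
  independence of the representative chosen.\<close>

theorem theorem2p2:
  fixes k :: nat and p r :: real
  assumes "CARD('n::{finite,linorder}) \<ge> 2"
    and "r > 0"
    and "k \<ge> 2"
    and "p \<ge> 1"
    and "p > (real CARD('n) - 1) / (real k - 1)"
  shows
    "(\<forall>\<omega> \<in> (Omega k p r :: 'n diff_form set).
        (AE x in lebesgue_on (ball 0 r). \<forall>\<xi>s. length \<xi>s = k - 1 \<longrightarrow>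
           set_integrable lebesgue {0..1} (S_integrand k \<omega> x \<xi>s)) \<and>
        S_op k \<omega> \<in> Omega (k - 1) p r) \<and>
     (\<forall>\<omega> \<in> (Omega k p r :: 'n diff_form set). \<forall>\<eta> \<in> Omega k p r.
        form_AE_eq k r \<omega> \<eta> \<longrightarrow> form_AE_eq (k - 1) r (S_op k \<omega>) (S_op k \<eta>)) \<and>
     (\<forall>\<omega> \<in> (Omega k p r :: 'n diff_form set). \<forall>\<eta> \<in> Omega k p r. \<forall>a b.
        form_AE_eq (k - 1) r (S_op k (\<lambda>x vs. a * \<omega> x vs + b * \<eta> x vs))
          (\<lambda>x \<xi>s. a * S_op k \<omega> x \<xi>s + b * S_op k \<eta> x \<xi>s)) \<and>
     (\<forall>\<omega> \<in> (Omega k p r :: 'n diff_form set).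
        Omega_norm (k - 1) p r (S_op k \<omega>)
          \<le> r * sqrt (real (CARD('n) choose k)) / (p * (real k - 1) - real CARD('n) + 1) powr (1 / p)
             * Omega_norm k p r \<omega>)"
proof -
  \<comment> \<open>Multiplied by \<open>real k - 1 > 0\<close>, the hypothesis on \<open>p\<close>
    becomes the convergence condition for the integral of
    \<open>t powr (p * (real k - 1) - real CARD('n))\<close> over \<open>[0, 1]\<close>.\<close>
  have pk: "p * (real k - 1) > real CARD('n) - 1"
    using assms(3,5) by (simp add: divide_less_eq)
  have int: "AE x in lebesgue_on (ball 0 r). \<forall>\<xi>s. length \<xi>s = k - 1 \<longrightarrow>
      set_integrable lebesgue {0..1} (S_integrand k \<omega> x \<xi>s)"
    if "\<omega> \<in> Omega k p r" for \<omega> :: "'n diff_form"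
    using AE_ray_regular[OF that assms(3) pk]
  proof eventually_elim
    case (elim x)
    then show ?case
      using integrable_ray[OF elim assms(4)] assms(3) by (simp add: set_integrable_S_integrand_iff)
  qed
  show ?thesis
    by (intro conjI ballI allI impI int S_op_in_Omega[OF _ assms(4,3) pk assms(2)]
        S_op_AE_cong[OF _ _ assms(4,3) pk] S_op_linear[OF _ _ assms(4,3) pk]
        Omega_norm_S_op_le[OF _ assms(4,3) pk assms(2)])
qed

end
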